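(* Let $D>0$, $L>0$, $\theta\in(-\pi/2,\pi/2)$ and $S>0$. Let $\gamma_1\ge\gamma_2\ge\gamma_3$ be the eigenvalues (all positive) of the matrix $\overline{\mathcal{W}}^{2\times3}$ defined in the context, let $\vartheta>0$ be the unique solution of the waterfilling equation $$S=\sum_{i=1}^{3}\left[\frac1\vartheta-\frac{\psi_2}{\gamma_i}\right]^+,$$ let $s_i=\left[\frac1\vartheta-\frac{\psi_2}{\gamma_i}\right]^+$ for $i=1,2,3$, and let $n_+$ be the number of indices $i$ with $s_i\neq0$. Put $$S^{(1)}=\frac{D^2\psi_2\left[D^4\psi_4-\sqrt{\left[D^4\psi_4-2\cos^2\theta\,(D^6\psi_6)\right]^2+4\cos^2\theta\,(D^5\bar\psi_5)^2}\right]}{2\cos^4\theta\left[D^6\psi_6\left(D^4\psi_4-\cos^2\theta\,D^6\psi_6\right)-(D^5\bar\psi_5)^2\right]}-1,$$ $$S^{(2)}=\frac{D^2\psi_2\left[D^4\psi_4+3\sqrt{\left[D^4\psi_4-2\cos^2\theta\,(D^6\psi_6)\right]^2+4\cos^2\theta\,(D^5\bar\psi_5)^2}\right]}{2\cos^4\theta\left[D^6\psi_6\left(D^4\psi_4-\cos^2\theta\,D^6\psi_6\right)-(D^5\bar\psi_5)^2\right]}-1.$$ Then $n_+=1$ if $S<S^{(1)}$; $n_+=2$ if $S^{(1)}\le S<S^{(2)}$; and $n_+=3$ if $S^{(2)}\le S$.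
   Context: Here $[x]^+=\max(x,0)$. For $D>0$, $L>0$, $\theta\in(-\pi/2,\pi/2)$, with $D_s=D\sin\theta$, $D_c=D\cos\theta$, define $$\Gamma=\arctan\frac{L/D-\sin\theta}{\cos\theta}+\arctan\frac{L/D+\sin\theta}{\cos\theta},\qquad \psi_2=\frac{\Gamma}{2LD\cos\theta},$$ $$\psi_4=\frac{1}{2D_c^2}\left[\frac{(D^2+L^2)-2D_s^2}{(D^2+L^2)^2-(2LD_s)^2}+\psi_2\right],$$ $$\bar\psi_5=-\frac{(D^2+L^2)D_s}{\left((D^2+L^2)^2-(2LD_s)^2\right)^2},$$ $$\psi_6=\frac{1}{4D_c^2}\,\frac{(D^2+L^2)^2-4D^2D_s^2}{\left((D^2+L^2)^2-(2LD_s)^2\right)^2}+\frac{3}{4D_c^2}\psi_4,$$ $$\overline{\mathcal{W}}^{2\times3}=\begin{bmatrix}\psi_2&0&0\\0&\psi_6D_c^4&\bar\psi_5D_c^3\\0&\bar\psi_5D_c^3&\psi_4D_c^2-\psi_6D_c^4\end{bmatrix}.$$ Equivalently, for $i=2,4,6$, $\psi_i=\frac1{2L}\int_{-L}^{L}\left((x-D_s)^2+D_c^2\right)^{-i/2}dx$, and $\bar\psi_5=\frac1{2L}\int_{-L}^{L}(x-D_s)\left((x-D_s)^2+D_c^2\right)^{-3}dx$. Interpretation: $S$ is the asymptotic received SNR $\overline{\mathsf{SNR}}_{RX}$, $S^{(i)}$ are the activation thresholds $\overline{\mathsf{SNR}}^{(i)}$, and $n_+$ is the optimal number of spatial streams when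 the transmitter uses two polarizations and the receiver three.
   Formalization: The text is false at the two thresholds: at S = S^(1) one has s_2 = 0, and at S = S^(2) one has s_3 = 0. The formal statement says n_+ = 1 if S ≤ S^(1), n_+ = 2 if S^(1) < S ≤ S^(2), and n_+ = 3 if S^(2) < S. *)

theory Defs
  imports "HOL-Analysis.Analysis" "Jordan_Normal_Form.Char_Poly"
begin

definition D_s :: "real \<Rightarrow> real \<Rightarrow> real" where
  "D_s D \<theta> = D * sin \<theta>"

definition D_c :: "real \<Rightarrow> real \<Rightarrow> real" where
  "D_c D \<theta> = D * cos \<theta>"

definition Gam :: "real \<Rightarrow> real \<Rightarrow> real \<Rightarrow> real" where
  "Gam D L \<theta> = arctan ((L / D - sin \<theta>) / cos \<theta>) + arctan ((L / D + sin \<theta>) / cos \<theta>)"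

definition \<psi>2 :: "real \<Rightarrow> real \<Rightarrow> real \<Rightarrow> real" where
  "\<psi>2 D L \<theta> = Gam D L \<theta> / (2 * L * D * cos \<theta>)"

definition \<psi>4 :: "real \<Rightarrow> real \<Rightarrow> real \<Rightarrow> real" where
  "\<psi>4 D L \<theta> = 1 / (2 * (D_c D \<theta>)\<^sup>2) *
     (((D\<^sup>2 + L\<^sup>2) - 2 * (D_s D \<theta>)\<^sup>2) / ((D\<^sup>2 + L\<^sup>2)\<^sup>2 - (2 * L * D_s D \<theta>)\<^sup>2) + \<psi>2 D L \<theta>)"

definition \<psi>5 :: "real \<Rightarrow> real \<Rightarrow> real \<Rightarrow> real" where
  "\<psi>5 D L \<theta> = - (((D\<^sup>2 + L\<^sup>2) * D_s D \<theta>) / ((D\<^sup>2 + L\<^sup>2)\<^sup>2 - (2 * L * D_s D \<theta>)\<^sup>2)\<^sup>2)"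

definition \<psi>6 :: "real \<Rightarrow> real \<Rightarrow> real \<Rightarrow> real" where
  "\<psi>6 D L \<theta> = 1 / (4 * (D_c D \<theta>)\<^sup>2) *
       (((D\<^sup>2 + L\<^sup>2)\<^sup>2 - 4 * D\<^sup>2 * (D_s D \<theta>)\<^sup>2) / ((D\<^sup>2 + L\<^sup>2)\<^sup>2 - (2 * L * D_s D \<theta>)\<^sup>2)\<^sup>2)
     + 3 / (4 * (D_c D \<theta>)\<^sup>2) * \<psi>4 D L \<theta>"

definition W23 :: "real \<Rightarrow> real \<Rightarrow> real \<Rightarrow> real mat" where
  "W23 D L \<theta> = mat_of_rows_list 3
     [[\<psi>2 D L \<theta>, 0, 0],
      [0, \<psi>6 D L \<theta> * D_c D \<theta> ^ 4, \<psi>5 D L \<theta> * D_c D \<theta> ^ 3],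
      [0, \<psi>5 D L \<theta> * D_c D \<theta> ^ 3, \<psi>4 D L \<theta> * (D_c D \<theta>)\<^sup>2 - \<psi>6 D L \<theta> * D_c D \<theta> ^ 4]]"

text \<open>The eigenvalues are listed with algebraic multiplicity, in non-increasing order;
  only the values of \<open>\<gamma>\<close> at 1, 2, 3 matter.\<close>

definition ordered_eigenvalues3 :: "real mat \<Rightarrow> (nat \<Rightarrow> real) \<Rightarrow> bool" where
  "ordered_eigenvalues3 A \<gamma> \<longleftrightarrow>
     \<gamma> 1 \<ge> \<gamma> 2 \<and> \<gamma> 2 \<ge> \<gamma> 3 \<and> char_poly A = (\<Prod>i=1..3. [:- \<gamma> i, 1:])"

definition stream_power :: "real \<Rightarrow> (nat \<Rightarrow> real) \<Rightarrow> real \<Rightarrow> nat \<Rightarrow> real" where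
  "stream_power p \<gamma> \<mu> i = max (1 / \<mu> - p / \<gamma> i) 0"

definition waterfilling :: "real \<Rightarrow> real \<Rightarrow> (nat \<Rightarrow> real) \<Rightarrow> real \<Rightarrow> bool" where
  "waterfilling S p \<gamma> \<mu> \<longleftrightarrow> \<mu> > 0 \<and> S = (\<Sum>i=1..3. stream_power p \<gamma> \<mu> i)"

text \<open>A stream whose water level is exactly reached has power 0 and is not counted. Hence each
  activation threshold itself still belongs to the range with fewer streams.\<close>

definition n_plus :: "real \<Rightarrow> (nat \<Rightarrow> real) \<Rightarrow> real \<Rightarrow> nat" where
  "n_plus p \<gamma> \<mu> = card {i \<in> {1..3}. stream_power p \<gamma> \<mu> i \<noteq> 0}"

definition S1 :: "real \<Rightarrow> real \<Rightarrow> real \<Rightarrow> real" where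
  "S1 D L \<theta> =
     (D\<^sup>2 * \<psi>2 D L \<theta> *
       (D ^ 4 * \<psi>4 D L \<theta>
        - sqrt ((D ^ 4 * \<psi>4 D L \<theta> - 2 * (cos \<theta>)\<^sup>2 * (D ^ 6 * \<psi>6 D L \<theta>))\<^sup>2
                + 4 * (cos \<theta>)\<^sup>2 * (D ^ 5 * \<psi>5 D L \<theta>)\<^sup>2)))
     / (2 * (cos \<theta>) ^ 4 *
         (D ^ 6 * \<psi>6 D L \<theta> * (D ^ 4 * \<psi>4 D L \<theta> - (cos \<theta>)\<^sup>2 * (D ^ 6 * \<psi>6 D L \<theta>))
          - (D ^ 5 * \<psi>5 D L \<theta>)\<^sup>2))
     - 1"

definition S2 :: "real \<Rightarrow> real \<Rightarrow> real \<Rightarrow> real" where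
  "S2 D L \<theta> =
     (D\<^sup>2 * \<psi>2 D L \<theta> *
       (D ^ 4 * \<psi>4 D L \<theta>
        + 3 * sqrt ((D ^ 4 * \<psi>4 D L \<theta> - 2 * (cos \<theta>)\<^sup>2 * (D ^ 6 * \<psi>6 D L \<theta>))\<^sup>2
                + 4 * (cos \<theta>)\<^sup>2 * (D ^ 5 * \<psi>5 D L \<theta>)\<^sup>2)))
     / (2 * (cos \<theta>) ^ 4 *
         (D ^ 6 * \<psi>6 D L \<theta> * (D ^ 4 * \<psi>4 D L \<theta> - (cos \<theta>)\<^sup>2 * (D ^ 6 * \<psi>6 D L \<theta>))
          - (D ^ 5 * \<psi>5 D L \<theta>)\<^sup>2))
     - 1"

end

theory Submission
  imports Defs
begin

text \<open>With \<open>c = D cos \<theta>\<close> and \<open>s = D sin \<theta>\<close>, the closed forms are means over \<open>u = x - s\<close>, so that the lower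
  \<open>2 \<times> 2\<close> block is the mean of \<open>v v\<^sup>T\<close> for the vector \<open>v = c (c, u) / (u\<^sup>2 + c\<^sup>2)\<^bsup>3/2\<^esup>\<close>. These vectors
  are not all parallel, so the block is positive definite, and its trace is the mean of
  \<open>c\<^sup>2 / (u\<^sup>2 + c\<^sup>2)\<^sup>2 \<le> 1 / (u\<^sup>2 + c\<^sup>2)\<close>, hence at most \<open>\<psi>2\<close>. So \<open>\<psi>2\<close> is the largest eigenvalue, the other
  two are the roots of a quadratic, and each activation threshold is the power needed to raise the
  water level to \<open>\<psi>2 / \<gamma> 2\<close> or \<open>\<psi>2 / \<gamma> 3\<close>.\<close>

section \<open>Determinants of small matrices\<close>

lemma det_two:
  fixes A :: "'a :: comm_ring_1 mat"
  assumes A: "A \<in> carrier_mat 2 2"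
  shows "Determinant.det A = A $$ (0,0) * A $$ (1,1) - A $$ (1,0) * A $$ (0,1)"
  by (subst laplace_expansion_column[OF A, of 0])
    (use A in \<open>auto simp: numeral_2_eq_2 cofactor_def mat_delete_def det_single\<close>)

lemma det_three:
  fixes A :: "'a :: comm_ring_1 mat"
  assumes A: "A \<in> carrier_mat 3 3"
  shows "Determinant.det A =
      A $$ (0,0) * (A $$ (1,1) * A $$ (2,2) - A $$ (1,2) * A $$ (2,1))
    - A $$ (1,0) * (A $$ (0,1) * A $$ (2,2) - A $$ (0,2) * A $$ (2,1))
    + A $$ (2,0) * (A $$ (0,1) * A $$ (1,2) - A $$ (0,2) * A $$ (1,1))"
proof -
  have del: "mat_delete A i 0 \<in> carrier_mat 2 2" for i
    using A by (auto simp: mat_delete_def)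
  have three: "{..<3} = {0, 1, 2 :: nat}" by auto
  have "Determinant.det A = A $$ (0,0) * cofactor A 0 0 + A $$ (1,0) * cofactor A 1 0 + A $$ (2,0) * cofactor A 2 0"
    by (subst laplace_expansion_column[OF A, of 0]) (simp_all add: three)
  then show ?thesis
    using A by (simp add: cofactor_def det_two[OF del]) (simp add: mat_delete_def numeral_2_eq_2 algebra_simps)
qed

section \<open>Integrals of powers of \<open>1 / (x\<^sup>2 + c\<^sup>2)\<close>\<close>

text \<open>A continuous nonnegative function with zero integral vanishes on the whole interval.
  This supplies the strict inequality behind positive definiteness of the block.\<close>

lemma has_integral_pos_of_continuous:
  fixes f :: "real \<Rightarrow> real"
  assumes I: "(f has_integral I) {a..b}" and ab: "a < b"
    and cont: "continuous_on {a..b} f"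
    and nonneg: "\<And>x. x \<in> {a..b} \<Longrightarrow> 0 \<le> f x"
    and x: "x \<in> {a..b}" "f x \<noteq> 0"
  shows "0 < I"
proof -
  have "0 \<le> I" using I nonneg by (rule has_integral_nonneg)
  moreover have "I \<noteq> 0"
    using has_integral_0_cbox_imp_0[of a b f x] cont nonneg x I ab by (auto simp: mem_box)
  ultimately show ?thesis by simp
qed

lemma has_integral_inverse_quadratic:
  fixes a b c :: real
  assumes "c > 0" "a \<le> b"
  shows "((\<lambda>x. 1 / (x\<^sup>2 + c\<^sup>2)) has_integral (arctan (b/c) - arctan (a/c)) / c) {a..b}"
proof -
  have "((\<lambda>x. arctan (x/c) / c) has_real_derivative 1 / (x\<^sup>2 + c\<^sup>2)) (at x within {a..b})" for x
  proof -
    have "x\<^sup>2 + c\<^sup>2 \<noteq> 0" using assms(1) by (simp add: sum_power2_eq_zero_iff)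
    then show ?thesis
      using assms(1) by (auto intro!: derivative_eq_intros simp: divide_simps power2_eq_square add.commute)
  qed
  then show ?thesis
    using fundamental_theorem_of_calculus[of a b "\<lambda>x. arctan (x/c) / c" "\<lambda>x. 1 / (x\<^sup>2 + c\<^sup>2)"] assms
    by (simp add: has_real_derivative_iff_has_vector_derivative diff_divide_distrib)
qed

text \<open>The reduction formula comes from differentiating \<open>x / (x\<^sup>2 + c\<^sup>2)\<^sup>n\<close>.\<close>

lemma has_integral_inverse_quadratic_reduce:
  fixes a b c I :: real
  assumes "c > 0" "a \<le> b" "n > 0"
    and I: "((\<lambda>x. 1 / (x\<^sup>2 + c\<^sup>2) ^ n) has_integral I) {a..b}"
  shows "((\<lambda>x. 1 / (x\<^sup>2 + c\<^sup>2) ^ Suc n) has_integral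
     (b / (b\<^sup>2 + c\<^sup>2) ^ n - a / (a\<^sup>2 + c\<^sup>2) ^ n + (2 * real n - 1) * I) / (2 * real n * c\<^sup>2)) {a..b}"
proof -
  let ?r = "\<lambda>x::real. x\<^sup>2 + c\<^sup>2"
  have r: "?r x > 0" for x using assms(1) by (simp add: add_nonneg_pos)
  obtain m where n: "n = Suc m" using \<open>n > 0\<close> gr0_conv_Suc by auto
  \<comment> \<open>The derivative of \<open>x / ?r x ^ n\<close> with \<open>x\<^sup>2\<close>
    replaced by \<open>?r x - c\<^sup>2\<close>, so that only two consecutive powers remain.\<close>
  define g where "g x = 2 * real n * c\<^sup>2 * (1 / ?r x ^ Suc n) - (2 * real n - 1) * (1 / ?r x ^ n)" for x
  have "((\<lambda>x. x / ?r x ^ n) has_real_derivative g x) (at x within {a..b})" for x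
  proof -
    have "((\<lambda>x. x / ?r x ^ n) has_real_derivative
       (?r x ^ n - x * (real n * (2 * x) * ?r x ^ (n - 1))) / (?r x ^ n * ?r x ^ n)) (at x within {a..b})"
      using r[of x] by (auto intro!: derivative_eq_intros simp: mult_ac)
    also have "(?r x ^ n - x * (real n * (2 * x) * ?r x ^ (n - 1))) / (?r x ^ n * ?r x ^ n)
        = (?r x - 2 * real n * x\<^sup>2) / ?r x ^ Suc n"
      using r[of x] unfolding n
      by (simp add: divide_simps) (simp add: algebra_simps power2_eq_square)?
    also have "\<dots> = g x"
    proof -
      have "?r x - 2 * real n * x\<^sup>2 = 2 * real n * c\<^sup>2 - (2 * real n - 1) * ?r x"
        by (simp add: algebra_simps)
      then show ?thesis using r[of x] by (auto simp: g_def diff_divide_distrib)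
    qed
    finally show ?thesis .
  qed
  then have "(g has_integral (b / ?r b ^ n - a / ?r a ^ n)) {a..b}"
    using assms by (intro fundamental_theorem_of_calculus)
      (auto simp: has_real_derivative_iff_has_vector_derivative)
  \<comment> \<open>Adding back the known power \<open>n\<close> and dividing by the coefficient
    isolates the power \<open>Suc n\<close>.\<close>
  then have "((\<lambda>x. (g x + (2 * real n - 1) * (1 / ?r x ^ n)) / (2 * real n * c\<^sup>2)) has_integral
     (b / ?r b ^ n - a / ?r a ^ n + (2 * real n - 1) * I) / (2 * real n * c\<^sup>2)) {a..b}"
    using I by (intro has_integral_divide has_integral_add has_integral_mult_right)
  then show ?thesis using assms by (simp add: g_def)
qed

lemma has_integral_ident_over_quadratic_cubed:
  fixes a b c :: real
  assumes "c > 0" "a \<le> b"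
  shows "((\<lambda>x. x / (x\<^sup>2 + c\<^sup>2) ^ 3) has_integral
     (1 / (a\<^sup>2 + c\<^sup>2)\<^sup>2 - 1 / (b\<^sup>2 + c\<^sup>2)\<^sup>2) / 4) {a..b}"
proof -
  let ?r = "\<lambda>x::real. x\<^sup>2 + c\<^sup>2"
  have r: "?r x \<noteq> 0" for x using assms(1) by (simp add: sum_power2_eq_zero_iff)
  have "((\<lambda>x. - (1 / (4 * (?r x)\<^sup>2))) has_real_derivative x / ?r x ^ 3) (at x within {a..b})" for x
    using r[of x]
    by (auto intro!: derivative_eq_intros simp: divide_simps power2_eq_square power3_eq_cube)
  then have "((\<lambda>x. x / ?r x ^ 3) has_integral (- (1 / (4 * (?r b)\<^sup>2)) - (- (1 / (4 * (?r a)\<^sup>2))))) {a..b}"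
    using assms by (intro fundamental_theorem_of_calculus)
      (auto simp: has_real_derivative_iff_has_vector_derivative)
  then show ?thesis by (simp add: diff_divide_distrib mult.commute)
qed

section \<open>Ordered roots and waterfilling\<close>

text \<open>Each of \<open>a1\<close>, \<open>b1\<close> is a root of the other product, hence at
  most its largest root. So they agree, the common factor cancels, and the argument repeats.\<close>

lemma ordered_linear_factors_unique:
  fixes a1 a2 a3 b1 b2 b3 :: "'a :: linordered_idom"
  assumes eq: "[:- a1, 1:] * [:- a2, 1:] * [:- a3, 1:] = [:- b1, 1:] * [:- b2, 1:] * [:- b3, 1:]"
    and "a1 \<ge> a2" "a2 \<ge> a3" "b1 \<ge> b2" "b2 \<ge> b3"
  shows "a1 = b1 \<and> a2 = b2 \<and> a3 = b3"
proof -
  have ev: "(x - a1) * (x - a2) * (x - a3) = (x - b1) * (x - b2) * (x - b3)" for x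
    using arg_cong[OF eq, of "\<lambda>p. poly p x"] by (simp add: algebra_simps)
  have "a1 = b1" using ev[of a1] ev[of b1] assms by auto
  \<comment> \<open>The rules that multiply out polynomials stay off, so that the factor
    \<open>[:- a1, 1:]\<close> remains visible for cancellation.\<close>
  then have eq2: "[:- a2, 1:] * [:- a3, 1:] = [:- b2, 1:] * [:- b3, 1:]"
    using eq unfolding mult.assoc by (simp del: mult_pCons_left mult_pCons_right)
  have ev: "(x - a2) * (x - a3) = (x - b2) * (x - b3)" for x
    using arg_cong[OF eq2, of "\<lambda>p. poly p x"] by (simp add: algebra_simps)
  have "a2 = b2" using ev[of a2] ev[of b2] assms by auto
  then have "[:- a3, 1:] = [:- b3, 1:]"
    using eq2 by (simp del: mult_pCons_left mult_pCons_right)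
  with \<open>a1 = b1\<close> \<open>a2 = b2\<close> show ?thesis by simp
qed

lemma waterfilling_alt:
  "waterfilling S p \<gamma> \<mu> \<longleftrightarrow> \<mu> > 0 \<and>
     S = max (1/\<mu> - p / \<gamma> 1) 0 + max (1/\<mu> - p / \<gamma> 2) 0 + max (1/\<mu> - p / \<gamma> 3) 0"
  by (simp add: waterfilling_def stream_power_def numeral_3_eq_3 numeral_2_eq_2)

text \<open>In terms of the water level \<open>w = 1/\<mu>\<close> the total power is continuous,
  zero at \<open>0\<close> and strictly increasing wherever it is positive, so it takes the value
  \<open>S\<close> exactly once.\<close>

lemma ex1_waterfilling:
  assumes S: "S > 0" and p: "p > 0" and pos: "\<And>i. i \<in> {1..3} \<Longrightarrow> \<gamma> i > 0"
  shows "\<exists>!\<mu>. waterfilling S p \<gamma> \<mu>"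
proof -
  define f where "f w = max (w - p / \<gamma> 1) 0 + max (w - p / \<gamma> 2) 0 + max (w - p / \<gamma> 3) 0" for w
  have q: "p / \<gamma> 1 > 0" "p / \<gamma> 2 > 0" "p / \<gamma> 3 > 0" using p pos by auto
  have wf: "waterfilling S p \<gamma> \<mu> \<longleftrightarrow> \<mu> > 0 \<and> f (1/\<mu>) = S" for \<mu>
    by (auto simp: waterfilling_alt f_def)
  \<comment> \<open>Below the first activation level the total power is constantly zero, hence the
    condition \<open>f w > 0\<close>.\<close>
  have less: "f w < f w'" if "w < w'" "f w > 0" for w w'
    using that unfolding f_def by (auto simp: max_def split: if_splits)
  \<comment> \<open>At level \<open>p / \<gamma> 1 + S\<close> the first stream alone already
    absorbs \<open>S\<close>.\<close>
  have "\<exists>w\<ge>0. w \<le> p / \<gamma> 1 + S \<and> f w = S"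
  proof (rule IVT')
    show "f 0 \<le> S" "S \<le> f (p / \<gamma> 1 + S)" "0 \<le> p / \<gamma> 1 + S"
      using q S by (auto simp: f_def max_def)
    show "continuous_on {0..p / \<gamma> 1 + S} f"
      unfolding f_def by (intro continuous_intros)
  qed
  then obtain w where w: "w \<ge> 0" "f w = S" by blast
  moreover have "f 0 = 0" using q by (auto simp: f_def max_def)
  ultimately have "w > 0" using S by (cases "w = 0") auto
  show ?thesis
  proof (rule ex1I[of _ "1/w"])
    show "waterfilling S p \<gamma> (1/w)" using w \<open>w > 0\<close> by (simp add: wf)
  next
    fix \<mu> assume "waterfilling S p \<gamma> \<mu>"
    then have "\<mu> > 0" "f (1/\<mu>) = S" by (auto simp: wf)
    then have "1/\<mu> = w" using less[of w "1/\<mu>"] less[of "1/\<mu>" w] w S by fastforce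
    then show "\<mu> = 1/w" by (auto simp: field_simps)
  qed
qed

text \<open>The bounds are the total powers at the levels \<open>p / \<gamma> 2\<close> and
  \<open>p / \<gamma> 3\<close>, where the second and third stream are about to start. At equality
  that stream still has power zero, hence \<open>\<le>\<close> on the side with fewer
  streams.\<close>

lemma n_plus_thresholds:
  assumes S: "S > 0" and p: "p > 0"
    and pos: "\<gamma> 3 > 0" and ord: "\<gamma> 1 \<ge> \<gamma> 2" "\<gamma> 2 \<ge> \<gamma> 3"
    and wf: "waterfilling S p \<gamma> \<mu>"
  shows "S \<le> p / \<gamma> 2 - p / \<gamma> 1 \<Longrightarrow> n_plus p \<gamma> \<mu> = 1"
    and "p / \<gamma> 2 - p / \<gamma> 1 < S \<Longrightarrow> S \<le> 2 * (p / \<gamma> 3) - p / \<gamma> 2 - p / \<gamma> 1 \<Longrightarrow> n_plus p \<gamma> \<mu> = 2"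
    and "2 * (p / \<gamma> 3) - p / \<gamma> 2 - p / \<gamma> 1 < S \<Longrightarrow> n_plus p \<gamma> \<mu> = 3"
proof -
  have q: "p / \<gamma> 1 \<le> p / \<gamma> 2" "p / \<gamma> 2 \<le> p / \<gamma> 3"
    using assms by (auto intro!: divide_left_mono mult_pos_pos)
  have S': "S = max (1/\<mu> - p / \<gamma> 1) 0 + max (1/\<mu> - p / \<gamma> 2) 0 + max (1/\<mu> - p / \<gamma> 3) 0"
    using wf by (simp add: waterfilling_alt)
  have [simp]: "{1..3} = {1, 2, 3 :: nat}" by auto
  have n: "n_plus p \<gamma> \<mu> = card {i \<in> {1, 2, 3}. p / \<gamma> i < 1/\<mu>}"
    unfolding n_plus_def stream_power_def by (intro arg_cong[of _ _ card]) (auto simp: max_def)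
  have set: "{i \<in> {1, 2, 3}. Q i} = (if Q 1 then {1} else {}) \<union> (if Q 2 then {2} else {})
      \<union> (if Q 3 then {3} else {})" for Q :: "nat \<Rightarrow> bool"
    by auto
  \<comment> \<open>Some stream is active because \<open>S > 0\<close>, and the first one has the
    lowest activation level.\<close>
  have 1: "p / \<gamma> 1 < 1/\<mu>" using S' S q by (auto simp: max_def split: if_splits)
  { assume "S \<le> p / \<gamma> 2 - p / \<gamma> 1"
    then have "1/\<mu> \<le> p / \<gamma> 2" using S' q 1 by (auto simp: max_def split: if_splits)
    then show "n_plus p \<gamma> \<mu> = 1" using 1 q unfolding n set by simp }
  { assume "p / \<gamma> 2 - p / \<gamma> 1 < S" "S \<le> 2 * (p / \<gamma> 3) - p / \<gamma> 2 - p / \<gamma> 1"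
    then have "p / \<gamma> 2 < 1/\<mu>" "1/\<mu> \<le> p / \<gamma> 3" using S' q 1 by (auto simp: max_def split: if_splits)
    then show "n_plus p \<gamma> \<mu> = 2" using 1 unfolding n set by simp }
  { assume "2 * (p / \<gamma> 3) - p / \<gamma> 2 - p / \<gamma> 1 < S"
    then have "p / \<gamma> 3 < 1/\<mu>" using S' q 1 by (auto simp: max_def split: if_splits)
    then show "n_plus p \<gamma> \<mu> = 3" using 1 q unfolding n set by simp }
qed

section \<open>The closed forms as integrals\<close>

context
  fixes D L \<theta> s c :: real
  assumes D: "D > 0" and L: "L > 0" and \<theta>: "\<theta> \<in> {-pi/2 <..< pi/2}"
  defines s: "s \<equiv> D_s D \<theta>" and c: "c \<equiv> D_c D \<theta>"
begin

lemma cos_pos: "cos \<theta> > 0"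
  using \<theta> by (intro cos_gt_zero_pi) auto

lemma D_c_pos: "c > 0"
  using cos_pos D by (simp add: c D_c_def)

lemma D_sq: "D\<^sup>2 = s\<^sup>2 + c\<^sup>2"
proof -
  have "s\<^sup>2 + c\<^sup>2 = D\<^sup>2 * ((sin \<theta>)\<^sup>2 + (cos \<theta>)\<^sup>2)"
    unfolding s c D_s_def D_c_def by (simp only: power_mult_distrib distrib_left)
  then show ?thesis by simp
qed

text \<open>As \<open>D\<^sup>2 = s\<^sup>2 + c\<^sup>2\<close>, the factors are
  \<open>D\<^sup>2 + L\<^sup>2\<close> minus and plus \<open>2 * L * s\<close>. They are the values
  of \<open>u\<^sup>2 + c\<^sup>2\<close> at the end points of integration.\<close>

lemma denominator_eq:
  "(D\<^sup>2 + L\<^sup>2)\<^sup>2 - (2 * L * s)\<^sup>2 = ((L - s)\<^sup>2 + c\<^sup>2) * ((- L - s)\<^sup>2 + c\<^sup>2)"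
  unfolding D_sq by (simp add: algebra_simps power2_eq_square)

text \<open>Substituting \<open>u = x - s\<close> shifts \<open>[-L, L]\<close> to this interval.
  The terms of \<open>Gam\<close> are the end point values of \<open>arctan (u / c)\<close>, the
  lower one with its sign absorbed by oddness.\<close>

lemma has_integral_psi2:
  "((\<lambda>u. 1 / (u\<^sup>2 + c\<^sup>2)) has_integral 2 * L * \<psi>2 D L \<theta>) {- L - s..L - s}"
proof -
  have 1: "(L - s) / c = (L / D - sin \<theta>) / cos \<theta>"
    using D by (simp add: s c D_s_def D_c_def field_simps)
  have 2: "(- L - s) / c = - ((L / D + sin \<theta>) / cos \<theta>)"
    using D cos_pos by (simp add: s c D_s_def D_c_def field_simps)
  have "(arctan ((L - s) / c) - arctan ((- L - s) / c)) / c = 2 * L * \<psi>2 D L \<theta>"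
    using L unfolding 1 2 arctan_minus by (simp add: \<psi>2_def Gam_def c D_c_def)
  then show ?thesis
    using has_integral_inverse_quadratic[of c "- L - s" "L - s"] D_c_pos L by simp
qed

text \<open>The reduction formula with \<open>n = 1\<close>: the boundary terms over the common
  denominator \<open>P * R\<close> give the rational part of \<open>\<psi>4\<close>, and the
  remaining integral gives \<open>\<psi>2\<close>.\<close>

lemma has_integral_psi4:
  "((\<lambda>u. 1 / (u\<^sup>2 + c\<^sup>2)\<^sup>2) has_integral 2 * L * \<psi>4 D L \<theta>) {- L - s..L - s}"
proof -
  define P R X where "P = (L - s)\<^sup>2 + c\<^sup>2" and "R = (- L - s)\<^sup>2 + c\<^sup>2"
    and "X = ((D\<^sup>2 + L\<^sup>2) - 2 * s\<^sup>2) / (P * R)"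
  have PR: "P > 0" "R > 0" using D_c_pos by (simp_all add: P_def R_def add_nonneg_pos)
  have "(L - s) * R - (- L - s) * P = 2 * L * ((D\<^sup>2 + L\<^sup>2) - 2 * s\<^sup>2)"
    unfolding D_sq P_def R_def by (simp add: algebra_simps power2_eq_square)
  then have 1: "(L - s) / P - (- L - s) / R = 2 * L * X"
    using PR by (simp add: diff_frac_eq X_def)
  have "\<psi>4 D L \<theta> = 1 / (2 * c\<^sup>2) * (X + \<psi>2 D L \<theta>)"
    unfolding \<psi>4_def X_def P_def R_def denominator_eq[symmetric] by (simp add: s c)
  then have "((L - s) / P - (- L - s) / R + 2 * L * \<psi>2 D L \<theta>) / (2 * c\<^sup>2) = 2 * L * \<psi>4 D L \<theta>"
    unfolding 1 by (simp add: algebra_simps add_divide_distrib)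
  then show ?thesis
    using has_integral_inverse_quadratic_reduce[of c "- L - s" "L - s" 1 "2 * L * \<psi>2 D L \<theta>"] has_integral_psi2 D_c_pos L
    by (simp add: P_def R_def numeral_2_eq_2)
qed

text \<open>The reduction formula with \<open>n = 2\<close>, starting from \<open>\<psi>4\<close>;
  the \<open>3 / 4\<close> in the definition is \<open>(2 * n - 1) / (2 * n)\<close>.\<close>

lemma has_integral_psi6:
  "((\<lambda>u. 1 / (u\<^sup>2 + c\<^sup>2) ^ 3) has_integral 2 * L * \<psi>6 D L \<theta>) {- L - s..L - s}"
proof -
  define P R X where "P = (L - s)\<^sup>2 + c\<^sup>2" and "R = (- L - s)\<^sup>2 + c\<^sup>2"
    and "X = ((D\<^sup>2 + L\<^sup>2)\<^sup>2 - 4 * D\<^sup>2 * s\<^sup>2) / (P * R)\<^sup>2"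
  have PR: "P > 0" "R > 0" using D_c_pos by (simp_all add: P_def R_def add_nonneg_pos)
  have "(L - s) * R\<^sup>2 - (- L - s) * P\<^sup>2 = 2 * L * ((D\<^sup>2 + L\<^sup>2)\<^sup>2 - 4 * D\<^sup>2 * s\<^sup>2)"
    unfolding D_sq P_def R_def by (simp add: algebra_simps power2_eq_square)
  then have 1: "(L - s) / P\<^sup>2 - (- L - s) / R\<^sup>2 = 2 * L * X"
    using PR by (simp add: diff_frac_eq X_def power_mult_distrib)
  have "\<psi>6 D L \<theta> = 1 / (4 * c\<^sup>2) * X + 3 / (4 * c\<^sup>2) * \<psi>4 D L \<theta>"
    unfolding \<psi>6_def X_def P_def R_def denominator_eq[symmetric] by (simp add: s c)
  then have "((L - s) / P\<^sup>2 - (- L - s) / R\<^sup>2 + 3 * (2 * L * \<psi>4 D L \<theta>)) / (4 * c\<^sup>2) = 2 * L * \<psi>6 D L \<theta>"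
    unfolding 1 by (simp add: algebra_simps add_divide_distrib)
  then show ?thesis
    using has_integral_inverse_quadratic_reduce[of c "- L - s" "L - s" 2 "2 * L * \<psi>4 D L \<theta>"] has_integral_psi4 D_c_pos L
    by (simp add: P_def R_def numeral_3_eq_3 numeral_2_eq_2)
qed

lemma has_integral_psi5:
  "((\<lambda>u. u / (u\<^sup>2 + c\<^sup>2) ^ 3) has_integral 2 * L * \<psi>5 D L \<theta>) {- L - s..L - s}"
proof -
  define P R where "P = (L - s)\<^sup>2 + c\<^sup>2" and "R = (- L - s)\<^sup>2 + c\<^sup>2"
  have PR: "P > 0" "R > 0" using D_c_pos by (simp_all add: P_def R_def add_nonneg_pos)
  \<comment> \<open>Here \<open>P - R = - 4 * L * s\<close> and
    \<open>P + R = 2 * (D\<^sup>2 + L\<^sup>2)\<close>.\<close>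
  have "P\<^sup>2 - R\<^sup>2 = - 8 * L * ((D\<^sup>2 + L\<^sup>2) * s)"
    unfolding D_sq P_def R_def by (simp add: algebra_simps power2_eq_square)
  then have 1: "1 / R\<^sup>2 - 1 / P\<^sup>2 = - 8 * L * (((D\<^sup>2 + L\<^sup>2) * s) / (P * R)\<^sup>2)"
    using PR by (simp add: diff_frac_eq power_mult_distrib mult.commute)
  have "\<psi>5 D L \<theta> = - (((D\<^sup>2 + L\<^sup>2) * s) / (P * R)\<^sup>2)"
    unfolding \<psi>5_def P_def R_def denominator_eq[symmetric] by (simp add: s)
  then have val: "(1 / R\<^sup>2 - 1 / P\<^sup>2) / 4 = 2 * L * \<psi>5 D L \<theta>"
    unfolding 1 by simp
  have "- L - s \<le> L - s" using L by simp
  from has_integral_ident_over_quadratic_cubed[OF D_c_pos this, folded P_def R_def]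
  show ?thesis unfolding val .
qed

text \<open>The left side is the trace of the lower block. Its eigenvalues being positive, each
  stays below \<open>\<psi>2\<close>, which therefore comes first in the order.\<close>

lemma trace_le_psi2: "\<psi>4 D L \<theta> * c\<^sup>2 \<le> \<psi>2 D L \<theta>"
proof -
  have "((\<lambda>u. 1 / (u\<^sup>2 + c\<^sup>2) - c\<^sup>2 * (1 / (u\<^sup>2 + c\<^sup>2)\<^sup>2)) has_integral
      2 * L * \<psi>2 D L \<theta> - c\<^sup>2 * (2 * L * \<psi>4 D L \<theta>)) {- L - s..L - s}"
    by (intro has_integral_diff has_integral_mult_right has_integral_psi2 has_integral_psi4)
  moreover have "0 \<le> 1 / (u\<^sup>2 + c\<^sup>2) - c\<^sup>2 * (1 / (u\<^sup>2 + c\<^sup>2)\<^sup>2)" for u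
  proof -
    have "u\<^sup>2 + c\<^sup>2 > 0" using D_c_pos by (simp add: add_nonneg_pos)
    then have "1 / (u\<^sup>2 + c\<^sup>2) - c\<^sup>2 * (1 / (u\<^sup>2 + c\<^sup>2)\<^sup>2) = u\<^sup>2 / (u\<^sup>2 + c\<^sup>2)\<^sup>2"
      by (simp add: divide_simps) (simp add: algebra_simps power2_eq_square)
    then show ?thesis by simp
  qed
  ultimately have "0 \<le> 2 * L * \<psi>2 D L \<theta> - c\<^sup>2 * (2 * L * \<psi>4 D L \<theta>)"
    by (rule has_integral_nonneg)
  then have "0 \<le> 2 * L * (\<psi>2 D L \<theta> - \<psi>4 D L \<theta> * c\<^sup>2)"
    by (simp add: algebra_simps)
  then show ?thesis using L by (simp add: zero_le_mult_iff)
qed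

text \<open>The form is the mean over \<open>[- L - s, L - s]\<close> of \<open>c\<^sup>2 (p c + q u)\<^sup>2 / (u\<^sup>2 + c\<^sup>2)\<^sup>3\<close>,
  whose numerator cannot vanish at both end points.\<close>

lemma block_pos_def:
  assumes "p \<noteq> 0 \<or> q \<noteq> 0"
  shows "0 < p\<^sup>2 * (\<psi>6 D L \<theta> * c ^ 4) + 2 * p * q * (\<psi>5 D L \<theta> * c ^ 3)
           + q\<^sup>2 * (\<psi>4 D L \<theta> * c\<^sup>2 - \<psi>6 D L \<theta> * c ^ 4)"
proof -
  define f where "f u = c\<^sup>2 * (p * c + q * u)\<^sup>2 / (u\<^sup>2 + c\<^sup>2) ^ 3" for u
  have r: "u\<^sup>2 + c\<^sup>2 > 0" for u using D_c_pos by (simp add: add_nonneg_pos)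
  \<comment> \<open>Rewriting \<open>u\<^sup>2\<close> as
    \<open>(u\<^sup>2 + c\<^sup>2) - c\<^sup>2\<close> leaves only the integrands of
    \<open>\<psi>4\<close>, \<open>\<psi>5\<close> and \<open>\<psi>6\<close>.\<close>
  have f: "f u = (p\<^sup>2 * c ^ 4 - q\<^sup>2 * c ^ 4) * (1 / (u\<^sup>2 + c\<^sup>2) ^ 3) + 2 * p * q * c ^ 3 * (u / (u\<^sup>2 + c\<^sup>2) ^ 3)
      + q\<^sup>2 * c\<^sup>2 * (1 / (u\<^sup>2 + c\<^sup>2)\<^sup>2)" for u
  proof -
    have "1 / (u\<^sup>2 + c\<^sup>2)\<^sup>2 = (u\<^sup>2 + c\<^sup>2) / (u\<^sup>2 + c\<^sup>2) ^ 3"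
      using r[of u] by (simp add: power2_eq_square power3_eq_cube)
    moreover have "c\<^sup>2 * (p * c + q * u)\<^sup>2 = (p\<^sup>2 * c ^ 4 - q\<^sup>2 * c ^ 4) + 2 * p * q * c ^ 3 * u
        + q\<^sup>2 * c\<^sup>2 * (u\<^sup>2 + c\<^sup>2)"
      by (simp add: algebra_simps power2_eq_square power3_eq_cube power4_eq_xxxx)
    ultimately show ?thesis unfolding f_def
      by (simp add: add_divide_distrib diff_divide_distrib distrib_left)
  qed
  let ?I = "(p\<^sup>2 * c ^ 4 - q\<^sup>2 * c ^ 4) * (2 * L * \<psi>6 D L \<theta>) + 2 * p * q * c ^ 3 * (2 * L * \<psi>5 D L \<theta>)
      + q\<^sup>2 * c\<^sup>2 * (2 * L * \<psi>4 D L \<theta>)"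
  have I: "(f has_integral ?I) {- L - s..L - s}"
    unfolding f[abs_def]
    by (intro has_integral_add has_integral_mult_right has_integral_psi4 has_integral_psi5 has_integral_psi6)
  have "\<exists>u \<in> {- L - s..L - s}. p * c + q * u \<noteq> 0"
  proof (rule ccontr)
    assume "\<not> ?thesis"
    then have 0: "p * c + q * (L - s) = 0" "p * c + q * (- L - s) = 0" using L by auto
    then have "q * L = 0" by (simp add: algebra_simps)
    then show False using 0 L D_c_pos assms by simp
  qed
  then obtain u where "u \<in> {- L - s..L - s}" "f u \<noteq> 0"
    using D_c_pos r unfolding f_def by (metis (no_types, lifting) divide_eq_0_iff less_irrefl mult_eq_0_iff power_not_zero)
  moreover have "continuous_on {- L - s..L - s} f"
    unfolding f_def[abs_def] using r by (intro continuous_intros) (auto simp: less_le)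
  moreover have "0 \<le> f u" for u using r[of u] by (simp add: f_def)
  ultimately have "0 < ?I"
    using has_integral_pos_of_continuous[OF I] L by auto
  also have "?I = 2 * L * (p\<^sup>2 * (\<psi>6 D L \<theta> * c ^ 4) + 2 * p * q * (\<psi>5 D L \<theta> * c ^ 3)
           + q\<^sup>2 * (\<psi>4 D L \<theta> * c\<^sup>2 - \<psi>6 D L \<theta> * c ^ 4))"
    by (simp add: algebra_simps)
  finally show ?thesis using L by (simp add: zero_less_mult_iff)
qed

end

section \<open>The spectrum of the matrix\<close>

text \<open>The matrix is block diagonal; the quadratic factor belongs to the lower block, with
  trace \<open>t\<close> and determinant \<open>a * (t - a) - b\<^sup>2\<close>.\<close>

lemma char_poly_W23:
  fixes D L \<theta> :: real
  defines "a \<equiv> \<psi>6 D L \<theta> * D_c D \<theta> ^ 4" and "b \<equiv> \<psi>5 D L \<theta> * D_c D \<theta> ^ 3"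
    and "t \<equiv> \<psi>4 D L \<theta> * (D_c D \<theta>)\<^sup>2"
  shows "char_poly (W23 D L \<theta>) = [:- \<psi>2 D L \<theta>, 1:] * [:a * (t - a) - b\<^sup>2, - t, 1:]"
proof -
  have W: "W23 D L \<theta> = mat_of_rows_list 3 [[\<psi>2 D L \<theta>, 0, 0], [0, a, b], [0, b, t - a]]"
    unfolding W23_def a_def b_def t_def ..
  have cW: "W23 D L \<theta> \<in> carrier_mat 3 3" by (simp add: W mat_of_rows_list_def numeral_3_eq_3)
  show ?thesis
    unfolding char_poly_def det_three[OF char_poly_matrix_closed[OF cW]]
    by (simp add: char_poly_matrix_def W mat_of_rows_list_def numeral_2_eq_2 numeral_3_eq_3
        algebra_simps power2_eq_square)
qed

text \<open>The two smaller eigenvalues are \<open>(t + r) / 2\<close> and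
  \<open>(t - r) / 2\<close>, with \<open>r\<^sup>2\<close> the discriminant. Up to scaling, the
  thresholds are built from \<open>\<psi>2\<close>, \<open>t\<close>, \<open>r\<close> and the
  determinant, so these are expressed through \<open>\<gamma>\<close>.\<close>

lemma eigenvalues_W23:
  fixes D L \<theta> :: real
  defines "a \<equiv> \<psi>6 D L \<theta> * D_c D \<theta> ^ 4" and "b \<equiv> \<psi>5 D L \<theta> * D_c D \<theta> ^ 3"
    and "t \<equiv> \<psi>4 D L \<theta> * (D_c D \<theta>)\<^sup>2"
  defines "r \<equiv> sqrt ((t - 2 * a)\<^sup>2 + 4 * b\<^sup>2)"
  assumes "D > 0" "L > 0" "\<theta> \<in> {-pi/2 <..< pi/2}"
    and ev: "ordered_eigenvalues3 (W23 D L \<theta>) \<gamma>"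
  shows "\<gamma> 1 = \<psi>2 D L \<theta>" "t = \<gamma> 2 + \<gamma> 3" "r = \<gamma> 2 - \<gamma> 3"
    and "\<gamma> 3 > 0" "\<gamma> 2 * \<gamma> 3 = a * (t - a) - b\<^sup>2"
proof -
  note pd = block_pos_def[OF assms(5-7), folded a_def b_def t_def]
  have a: "a > 0" using pd[of 1 0] by simp
  \<comment> \<open>At the vector \<open>(b, - a)\<close> the form equals \<open>a\<close> times the
    determinant.\<close>
  have "0 < a * (a * (t - a) - b\<^sup>2)"
    using pd[of b "- a"] a by (simp add: algebra_simps power2_eq_square)
  then have det: "0 < a * (t - a) - b\<^sup>2" using a by (simp add: zero_less_mult_iff)
  then have "0 < a * (t - a)" using zero_le_power2[of b] by linarith
  then have t: "t > 0" using a by (simp add: zero_less_mult_iff)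
  have "r\<^sup>2 = (t - 2 * a)\<^sup>2 + 4 * b\<^sup>2"
    unfolding r_def by (rule real_sqrt_pow2) simp
  also have "\<dots> = t\<^sup>2 - 4 * (a * (t - a) - b\<^sup>2)"
    by (simp add: algebra_simps power2_eq_square)
  finally have r: "r\<^sup>2 = t\<^sup>2 - 4 * (a * (t - a) - b\<^sup>2)" .
  have r_nonneg: "r \<ge> 0" by (simp add: r_def)
  \<comment> \<open>The bound \<open>r < t\<close> makes the smaller root positive and keeps the
    larger one below the trace.\<close>
  have "r\<^sup>2 < t\<^sup>2" using r det by simp
  then have rt: "r < t" by (rule power2_less_imp_less) (use t in simp)
  have le: "(t + r) / 2 \<le> \<psi>2 D L \<theta>"
    using rt trace_le_psi2[OF assms(5-7)] by (simp add: t_def)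
  have prod: "(t + r) / 2 * ((t - r) / 2) = a * (t - a) - b\<^sup>2"
  proof -
    have "(t + r) / 2 * ((t - r) / 2) = (t\<^sup>2 - r\<^sup>2) / 4"
      by (simp add: algebra_simps power2_eq_square)
    then show ?thesis unfolding r by simp
  qed
  have quad: "[:a * (t - a) - b\<^sup>2, - t, 1:] = [:- ((t + r) / 2), 1:] * [:- ((t - r) / 2), 1:]"
    unfolding prod[symmetric] by (simp add: field_simps)
  have prod3: "prod f {1..3} = f 1 * f 2 * f 3" for f :: "nat \<Rightarrow> real poly"
    by (simp add: numeral_3_eq_3 numeral_2_eq_2)
  have "[:- \<gamma> 1, 1:] * [:- \<gamma> 2, 1:] * [:- \<gamma> 3, 1:] = char_poly (W23 D L \<theta>)"
    using ev unfolding ordered_eigenvalues3_def prod3 by (elim conjE) (erule sym)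
  also have "\<dots> = [:- \<psi>2 D L \<theta>, 1:] * ([:- ((t + r) / 2), 1:] * [:- ((t - r) / 2), 1:])"
    unfolding char_poly_W23 a_def[symmetric] b_def[symmetric] t_def[symmetric] quad ..
  finally have "[:- \<gamma> 1, 1:] * [:- \<gamma> 2, 1:] * [:- \<gamma> 3, 1:] =
      [:- \<psi>2 D L \<theta>, 1:] * [:- ((t + r) / 2), 1:] * [:- ((t - r) / 2), 1:]"
    unfolding mult.assoc .
  from ordered_linear_factors_unique[OF this] ev le r_nonneg
  have eqs: "\<gamma> 1 = \<psi>2 D L \<theta> \<and> \<gamma> 2 = (t + r) / 2 \<and> \<gamma> 3 = (t - r) / 2"
    by (simp add: ordered_eigenvalues3_def)
  then show "\<gamma> 1 = \<psi>2 D L \<theta>" "t = \<gamma> 2 + \<gamma> 3" "r = \<gamma> 2 - \<gamma> 3"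
    by (simp_all add: field_simps)
  show "\<gamma> 3 > 0" using eqs rt by simp
  show "\<gamma> 2 * \<gamma> 3 = a * (t - a) - b\<^sup>2" using eqs prod by metis
qed

section \<open>The activation thresholds\<close>

text \<open>Both thresholds are instances, with \<open>x = - 1\<close> and \<open>x = 3\<close>, and
  \<open>k\<close> stands for the cosine. Multiplied by \<open>D\<^sup>2\<close>, the quantities
  \<open>a\<close>, \<open>b\<close>, \<open>t\<close> become powers of \<open>k\<close> times the
  normalized ones, so numerator and denominator on the right carry the same factor
  \<open>k\<^sup>2 / D ^ 4\<close>, which cancels.\<close>

lemma threshold_fraction:
  fixes D k p x p4 p5 p6 :: real
  defines "a \<equiv> p6 * (D * k) ^ 4" and "b \<equiv> p5 * (D * k) ^ 3" and "t \<equiv> p4 * (D * k)\<^sup>2"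
  assumes D: "D > 0" and k: "k > 0"
  shows "(D\<^sup>2 * p * (D ^ 4 * p4 + x * sqrt ((D ^ 4 * p4 - 2 * k\<^sup>2 * (D ^ 6 * p6))\<^sup>2 + 4 * k\<^sup>2 * (D ^ 5 * p5)\<^sup>2)))
     / (2 * k ^ 4 * (D ^ 6 * p6 * (D ^ 4 * p4 - k\<^sup>2 * (D ^ 6 * p6)) - (D ^ 5 * p5)\<^sup>2))
   = p * (t + x * sqrt ((t - 2 * a)\<^sup>2 + 4 * b\<^sup>2)) / (2 * (a * (t - a) - b\<^sup>2))"
proof -
  let ?r = "sqrt ((D ^ 4 * p4 - 2 * k\<^sup>2 * (D ^ 6 * p6))\<^sup>2 + 4 * k\<^sup>2 * (D ^ 5 * p5)\<^sup>2)"
  define N where "N = D\<^sup>2 * p * (D ^ 4 * p4 + x * ?r)"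
  define M where "M = 2 * k ^ 4 * (D ^ 6 * p6 * (D ^ 4 * p4 - k\<^sup>2 * (D ^ 6 * p6)) - (D ^ 5 * p5)\<^sup>2)"
  have a: "D\<^sup>2 * a = k ^ 4 * (D ^ 6 * p6)" and b: "D\<^sup>2 * b = k ^ 3 * (D ^ 5 * p5)"
    and t: "D\<^sup>2 * t = k\<^sup>2 * (D ^ 4 * p4)"
    by (simp_all add: a_def b_def t_def power_mult_distrib flip: power_add)
  have "D\<^sup>2 * sqrt ((t - 2 * a)\<^sup>2 + 4 * b\<^sup>2) = sqrt ((D\<^sup>2)\<^sup>2 * ((t - 2 * a)\<^sup>2 + 4 * b\<^sup>2))"
    by (simp only: real_sqrt_mult real_sqrt_abs abs_power2)
  also have "(D\<^sup>2)\<^sup>2 * ((t - 2 * a)\<^sup>2 + 4 * b\<^sup>2)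
      = (k\<^sup>2)\<^sup>2 * ((D ^ 4 * p4 - 2 * k\<^sup>2 * (D ^ 6 * p6))\<^sup>2 + 4 * k\<^sup>2 * (D ^ 5 * p5)\<^sup>2)"
  proof -
    have "(D\<^sup>2)\<^sup>2 * ((t - 2 * a)\<^sup>2 + 4 * b\<^sup>2) = (D\<^sup>2 * t - 2 * (D\<^sup>2 * a))\<^sup>2 + 4 * (D\<^sup>2 * b)\<^sup>2"
      by (simp add: algebra_simps power2_eq_square)
    also have "\<dots> = (k\<^sup>2)\<^sup>2 * ((D ^ 4 * p4 - 2 * k\<^sup>2 * (D ^ 6 * p6))\<^sup>2 + 4 * k\<^sup>2 * (D ^ 5 * p5)\<^sup>2)"
      unfolding a b t
      by (simp add: algebra_simps power2_eq_square power3_eq_cube power4_eq_xxxx)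
    finally show ?thesis .
  qed
  also have "sqrt \<dots> = k\<^sup>2 * ?r"
    by (simp only: real_sqrt_mult real_sqrt_abs abs_power2)
  finally have r: "D\<^sup>2 * sqrt ((t - 2 * a)\<^sup>2 + 4 * b\<^sup>2) = k\<^sup>2 * ?r" .
  have "D ^ 4 * (p * (t + x * sqrt ((t - 2 * a)\<^sup>2 + 4 * b\<^sup>2)))
      = D\<^sup>2 * p * (D\<^sup>2 * t + x * (D\<^sup>2 * sqrt ((t - 2 * a)\<^sup>2 + 4 * b\<^sup>2)))"
    by (simp add: algebra_simps power2_eq_square power4_eq_xxxx)
  also have "\<dots> = k\<^sup>2 * N"
    unfolding r t N_def by (simp add: algebra_simps)
  finally have num: "p * (t + x * sqrt ((t - 2 * a)\<^sup>2 + 4 * b\<^sup>2)) = k\<^sup>2 * N / D ^ 4"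
    using D by (simp add: field_simps)
  have "D ^ 4 * (2 * (a * (t - a) - b\<^sup>2))
      = 2 * (D\<^sup>2 * a * (D\<^sup>2 * t - D\<^sup>2 * a) - (D\<^sup>2 * b)\<^sup>2)"
    by (simp add: algebra_simps power2_eq_square power4_eq_xxxx)
  also have "\<dots> = k\<^sup>2 * M"
    unfolding a b t M_def
    by (simp add: algebra_simps power2_eq_square power3_eq_cube power4_eq_xxxx)
  finally have "D ^ 4 * (2 * (a * (t - a) - b\<^sup>2)) = k\<^sup>2 * M" .
  then have den: "2 * (a * (t - a) - b\<^sup>2) = k\<^sup>2 * M / D ^ 4"
    using D by (simp add: field_simps)
  show ?thesis
    unfolding num den N_def[symmetric] M_def[symmetric] using D k by simp
qed

theorem mainTheorem4:
  fixes D L \<theta> S :: real and \<gamma> :: "nat \<Rightarrow> real"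
  assumes "D > 0" and "L > 0" and "\<theta> \<in> {-pi/2 <..< pi/2}" and "S > 0"
    and "ordered_eigenvalues3 (W23 D L \<theta>) \<gamma>"
  shows "(\<forall>i\<in>{1..3}. \<gamma> i > 0) \<and>
    (\<exists>!\<mu>. waterfilling S (\<psi>2 D L \<theta>) \<gamma> \<mu>) \<and>
    (\<forall>\<mu>. waterfilling S (\<psi>2 D L \<theta>) \<gamma> \<mu> \<longrightarrow>
      (S \<le> S1 D L \<theta> \<longrightarrow> n_plus (\<psi>2 D L \<theta>) \<gamma> \<mu> = 1) \<and>
      (S1 D L \<theta> < S \<and> S \<le> S2 D L \<theta> \<longrightarrow> n_plus (\<psi>2 D L \<theta>) \<gamma> \<mu> = 2) \<and>
      (S2 D L \<theta> < S \<longrightarrow> n_plus (\<psi>2 D L \<theta>) \<gamma> \<mu> = 3))"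
proof -
  note ev = eigenvalues_W23[OF assms(1,2,3,5)]
  have ord: "\<gamma> 1 \<ge> \<gamma> 2" "\<gamma> 2 \<ge> \<gamma> 3" using assms(5) by (auto simp: ordered_eigenvalues3_def)
  have pos: "\<gamma> 3 > 0" "\<gamma> 2 > 0" "\<gamma> 1 > 0" using ev(4) ord by auto
  have p: "\<psi>2 D L \<theta> > 0" using pos ev(1) by simp
  have "{1..3} = {1, 2, 3 :: nat}" by auto
  then have all_pos: "\<forall>i\<in>{1..3}. \<gamma> i > 0" using pos by auto
  have "cos \<theta> > 0" using assms(3) by (intro cos_gt_zero_pi) auto
  \<comment> \<open>The trace equation \<open>ev(2)\<close> is unfolded last, since the trace also
    occurs inside the expressions that \<open>ev(5)\<close> and \<open>ev(3)\<close>
    replace.\<close>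
  note frac = threshold_fraction[OF \<open>D > 0\<close> this, of "\<psi>2 D L \<theta>" "\<psi>4 D L \<theta>" _ "\<psi>6 D L \<theta>" "\<psi>5 D L \<theta>",
    folded D_c_def, folded ev(5), unfolded ev(3), unfolded ev(2)]
  have "S1 D L \<theta> = \<psi>2 D L \<theta> * (\<gamma> 2 + \<gamma> 3 - (\<gamma> 2 - \<gamma> 3)) / (2 * (\<gamma> 2 * \<gamma> 3)) - 1"
    unfolding S1_def frac[of "- 1", unfolded mult_minus1 add_uminus_conv_diff] ..
  \<comment> \<open>The bracket collapses to \<open>2 * \<gamma> 3\<close>, and the subtracted
    \<open>1\<close> is \<open>\<psi>2 D L \<theta> / \<gamma> 1\<close>.\<close>
  also have "\<dots> = \<psi>2 D L \<theta> / \<gamma> 2 - \<psi>2 D L \<theta> / \<gamma> 1"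
    using pos p ev(1) by (simp add: field_simps)
  finally have S1: "S1 D L \<theta> = \<psi>2 D L \<theta> / \<gamma> 2 - \<psi>2 D L \<theta> / \<gamma> 1" .
  have "S2 D L \<theta> = \<psi>2 D L \<theta> * (\<gamma> 2 + \<gamma> 3 + 3 * (\<gamma> 2 - \<gamma> 3)) / (2 * (\<gamma> 2 * \<gamma> 3)) - 1"
    unfolding S2_def frac[of 3] ..
  \<comment> \<open>Here the bracket is \<open>4 * \<gamma> 2 - 2 * \<gamma> 3\<close>.\<close>
  also have "\<dots> = 2 * (\<psi>2 D L \<theta> / \<gamma> 3) - \<psi>2 D L \<theta> / \<gamma> 2 - \<psi>2 D L \<theta> / \<gamma> 1"
    using pos p ev(1) by (simp add: field_simps)
  finally have S2: "S2 D L \<theta> = 2 * (\<psi>2 D L \<theta> / \<gamma> 3) - \<psi>2 D L \<theta> / \<gamma> 2 - \<psi>2 D L \<theta> / \<gamma> 1" .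
  show ?thesis
    using all_pos ex1_waterfilling[of S "\<psi>2 D L \<theta>" \<gamma>] n_plus_thresholds[OF \<open>S > 0\<close> p pos(1) ord]
      \<open>S > 0\<close> p unfolding S1 S2 by auto
qed

end
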